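(* There exists a uniform (absolute) constant $C_0>0$ such that the following holds. Let $h\colon \mathbb{R}\to \mathbb{R}$ be an increasing homeomorphism. Then $$\frac{\rho_h(x,y)}{4}\leq K_h(x,y) \leq C_0 \max \left\{\rho_h(x,y), \frac{2}{y}\int_{-y/4}^{y/4} \rho_h(x+z,y-|z|)\, dz \right\}$$ for all $x\in \mathbb{R}$ and $y>0$.
   Context: For an increasing homeomorphism $h\colon\mathbb{R}\to\mathbb{R}$, $x\in\mathbb{R}$, $t>0$, the symmetric distortion function is $$\rho_h(x,t)= \max \left\{ \frac{|h(x+t)-h(x)|}{|h(x)-h(x-t)|}, \frac{|h(x)-h(x-t)|}{|h(x+t)-h(x)|}\right\}.$$ $\mathbb{H}=\{(x,y)\in\mathbb{R}^2:y>0\}$ is the upper half-plane. The Beurling--Ahlfors extension of $h$ is the map $H\colon\overline{\mathbb{H}}\to\overline{\mathbb{H}}$ (where $\overline{\mathbb H}=\mathbb H\cup\mathbb R$) with $H|_{\mathbb{R}}=h$ and $H(x,y)=u(x,y)+iv(x,y)$ for $x\in\mathbb{R}$, $y>0$, where $$u(x,y)=\frac{1}{2y}\int_{x-y}^{x+y} h(t)\,dt,\qquad v(x,y)=\frac{1}{2y}\left( \int_{x}^{x+y} h(t)\,dt - \int_{x-y}^{x} h(t)\,dt\right).$$ It is a homeomorphism of $\overline{\mathbb{H}}$ and a $C^1$-diffeomorphism of $\mathbb{H}$. $K_h$ denotes the quasiconformal dilatation of $H$ in $\mathbb{H}$: $K_h(x,y)=\inf\{K\ge1: \|DH(x,y)\|^2\le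 K J_H(x,y)\}$, where $\|DH\|$ is the operator norm of the differential matrix and $J_H$ is the Jacobian determinant. *)

theory Defs
  imports "HOL-Analysis.Analysis"
begin

definition symmetric_distortion :: "(real \<Rightarrow> real) \<Rightarrow> real \<Rightarrow> real \<Rightarrow> real" where
  "symmetric_distortion h x t =
     max (\<bar>h (x + t) - h x\<bar> / \<bar>h x - h (x - t)\<bar>)
         (\<bar>h x - h (x - t)\<bar> / \<bar>h (x + t) - h x\<bar>)"

definition ba_u :: "(real \<Rightarrow> real) \<Rightarrow> real \<Rightarrow> real \<Rightarrow> real" where
  "ba_u h x y = 1 / (2 * y) * integral {x - y..x + y} h"

definition ba_v :: "(real \<Rightarrow> real) \<Rightarrow> real \<Rightarrow> real \<Rightarrow> real" where
  "ba_v h x y = 1 / (2 * y) * (integral {x..x + y} h - integral {x - y..x} h)"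

text \<open>
  The extension acts on the closed upper half-plane, with the plane modelled as
  \<^typ>\<open>real^2\<close>; its values below the real axis are irrelevant.
\<close>
definition beurling_ahlfors :: "(real \<Rightarrow> real) \<Rightarrow> real^2 \<Rightarrow> real^2" where
  "beurling_ahlfors h p =
     (if p $ 2 > 0 then vector [ba_u h (p $ 1) (p $ 2), ba_v h (p $ 1) (p $ 2)]
      else vector [h (p $ 1), 0])"

text \<open>
  Taken in the extended reals, so that the infimum of the empty set is \<open>\<infinity>\<close>.
\<close>
definition dilatation :: "(real^2 \<Rightarrow> real^2) \<Rightarrow> real^2 \<Rightarrow> ereal" where
  "dilatation F p =
     Inf {ereal K |K. K \<ge> 1 \<and>
       (onorm (\<lambda>w. jacobian F (at p) *v w))\<^sup>2 \<le> K * det (jacobian F (at p))}"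

definition ba_dilatation :: "(real \<Rightarrow> real) \<Rightarrow> real \<Rightarrow> real \<Rightarrow> ereal" where
  "ba_dilatation h x y = dilatation (beurling_ahlfors h) (vector [x, y])"

end

theory Submission
  imports Defs
begin

text \<open>
  Fix \<open>x\<close> and \<open>y > 0\<close>, and let \<open>A = h (x + y) - h x\<close> and \<open>B = h x - h (x - y)\<close>, so that
  \<open>\<rho>\<^sub>h(x, y) = max (A / B) (B / A)\<close>. Let \<open>\<alpha>\<close> be the amount by which the mean of \<open>h\<close> over
  \<open>[x, x + y]\<close> falls short of \<open>h (x + y)\<close>, and \<open>\<beta>\<close> the amount by which its mean over \<open>[x - y, x]\<close>
  exceeds \<open>h (x - y)\<close>; monotonicity gives \<open>0 < \<alpha> \<le> A\<close> and \<open>0 < \<beta> \<le> B\<close>. In these four numbers the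
  derivative of the extension \<open>H\<close> is
  \<open>2 y DH = ((A + B, \<alpha> - \<beta>), (A - B, \<alpha> + \<beta>))\<close>,
  whose determinant is \<open>2 (A \<beta> + B \<alpha>)\<close> and whose Frobenius norm squared is
  \<open>2 (A\<^sup>2 + B\<^sup>2 + \<alpha>\<^sup>2 + \<beta>\<^sup>2)\<close>.

  For the lower bound, the first column alone gives \<open>\<parallel>2 y DH\<parallel>\<^sup>2 \<ge> 2 (A\<^sup>2 + B\<^sup>2)\<close>, while the
  determinant is at most \<open>4 A B\<close>.

  For the upper bound, the operator norm is at most the Frobenius norm, so that
  \<open>K\<^sub>h \<le> (A\<^sup>2 + B\<^sup>2 + \<alpha>\<^sup>2 + \<beta>\<^sup>2) / (A \<beta> + B \<alpha>)\<close>. Suppose \<open>B \<le> A\<close>; then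
  \<open>K\<^sub>h \<le> 4 A\<^sup>2 / (A \<beta> + B \<alpha>)\<close>. If \<open>\<alpha> \<ge> A / 8\<close>, this is at most \<open>32 A / B\<close>. If \<open>\<alpha> < A / 8\<close>, then
  \<open>h\<close> already rises by at least \<open>A / 2\<close> on \<open>[x, x + y / 2]\<close>. For \<open>-y/4 \<le> z \<le> 0\<close> the distortion at
  \<open>x + z\<close> with radius \<open>y - \<bar>z\<bar>\<close> compares the increments of \<open>h\<close> between the points \<open>x - y\<close>,
  \<open>x + z\<close> and \<open>x + y + 2 z\<close>. The right-hand increment is at least \<open>A / 2\<close>, and the left-hand one,
  \<open>D z = h (x + z) - h (x - y)\<close>, has integral at most \<open>y \<beta>\<close>. By convexity of the inverse the
  integral of \<open>1 / D\<close> is then at least \<open>y / (16 \<beta>)\<close>, so the averaged distortion is at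
  least \<open>A / (16 \<beta>)\<close> (\<open>average_distortion_ge_of_small_right_gap\<close>), which controls
  \<open>4 A\<^sup>2 / (A \<beta>)\<close>. The case \<open>A \<le> B\<close> follows by passing to the reflected function
  \<open>t \<mapsto> - h (- t)\<close>, which exchanges \<open>A\<close> with \<open>B\<close> and \<open>\<alpha>\<close> with \<open>\<beta>\<close>. The constant is \<open>64\<close>.
\<close>

section \<open>Gaps between means and endpoint values\<close>

definition right_gap :: "(real \<Rightarrow> real) \<Rightarrow> real \<Rightarrow> real \<Rightarrow> real" where
  "right_gap h x y = h (x + y) - integral {x..x + y} h / y"

definition left_gap :: "(real \<Rightarrow> real) \<Rightarrow> real \<Rightarrow> real \<Rightarrow> real" where
  "left_gap h x y = integral {x - y..x} h / y - h (x - y)"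

text \<open>
  Reflecting the graph of \<open>h\<close> in the origin exchanges the two sides of \<open>x\<close>, so that each estimate
  need be proved on one side only.
\<close>
lemma left_gap_eq_right_gap_reflect:
  "left_gap h x y = right_gap (\<lambda>t. - h (- t)) (- x) y"
proof -
  have "integral {- x..- x + y} (\<lambda>t. h (- t)) = integral {x - y..x} h"
    using Henstock_Kurzweil_Integration.integral_reflect_real[of x "x - y" h] by simp
  then show ?thesis
    by (simp add: left_gap_def right_gap_def)
qed

lemma right_gap_eq_left_gap_reflect:
  "right_gap h x y = left_gap (\<lambda>t. - h (- t)) (- x) y"
  using left_gap_eq_right_gap_reflect[of "\<lambda>t. - h (- t)" "- x" y] by simp

lemma symmetric_distortion_reflect:
  "symmetric_distortion (\<lambda>t. - h (- t)) (- x) t = symmetric_distortion h x t"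
proof -
  have "- h (- (- x + t)) - - h (- (- x)) = h x - h (x - t)"
    and "- h (- (- x)) - - h (- (- x - t)) = h (x + t) - h x"
    by (simp_all add: add.commute)
  then show ?thesis
    unfolding symmetric_distortion_def by (simp only: max.commute)
qed

lemma right_gap_le:
  fixes h :: "real \<Rightarrow> real"
  assumes "mono h" "continuous_on UNIV h" "0 < y"
  shows "right_gap h x y \<le> h (x + y) - h x"
proof -
  have int: "h integrable_on {x..x + y}"
    by (intro integrable_continuous_real continuous_on_subset[OF assms(2)]) auto
  have "integral {x..x + y} (\<lambda>_. h x) \<le> integral {x..x + y} h"
    by (rule integral_le[OF _ int]) (use assms(1) in \<open>auto simp: mono_def\<close>)
  then show ?thesis
    using assms(3) by (simp add: right_gap_def field_simps)
qed

text \<open>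
  On the left half of \<open>[x, x + y]\<close> the function stays at or below \<open>h (x + y / 2)\<close>, and this half
  carries half of the mean. Hence a small gap forces most of the increment to occur on
  \<open>[x, x + y / 2]\<close>.
\<close>
lemma half_increment_le_right_gap:
  fixes h :: "real \<Rightarrow> real"
  assumes "mono h" "continuous_on UNIV h" "0 < y"
  shows "(h (x + y) - h (x + y / 2)) / 2 \<le> right_gap h x y"
proof -
  have int: "h integrable_on {a..b}" for a b
    by (intro integrable_continuous_real continuous_on_subset[OF assms(2)]) auto
  have "integral {x..x + y / 2} h \<le> integral {x..x + y / 2} (\<lambda>_. h (x + y / 2))"
    by (rule integral_le[OF int]) (use assms(1) in \<open>auto simp: mono_def\<close>)
  moreover have "integral {x + y / 2..x + y} h \<le> integral {x + y / 2..x + y} (\<lambda>_. h (x + y))"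
    by (rule integral_le[OF int]) (use assms(1) in \<open>auto simp: mono_def\<close>)
  moreover have "integral {x..x + y / 2} h + integral {x + y / 2..x + y} h = integral {x..x + y} h"
    by (rule Henstock_Kurzweil_Integration.integral_combine[OF _ _ int]) (use assms(3) in auto)
  ultimately have "integral {x..x + y} h \<le> y * ((h (x + y / 2) + h (x + y)) / 2)"
    using assms(3) by (simp add: field_simps)
  then have "integral {x..x + y} h / y \<le> (h (x + y / 2) + h (x + y)) / 2"
    using assms(3) by (simp add: field_simps)
  then show ?thesis
    by (simp add: right_gap_def field_simps)
qed

lemma right_gap_pos:
  fixes h :: "real \<Rightarrow> real"
  assumes "strict_mono h" "continuous_on UNIV h" "0 < y"
  shows "0 < right_gap h x y"
  using half_increment_le_right_gap[OF strict_mono_mono[OF assms(1)] assms(2,3), of x]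
    strict_monoD[OF assms(1), of "x + y / 2" "x + y"] assms(3) by simp

lemma reflect_strict_mono:
  fixes h :: "real \<Rightarrow> real"
  assumes "strict_mono h"
  shows "strict_mono (\<lambda>t. - h (- t))"
  using assms by (simp add: strict_mono_def)

lemma reflect_continuous:
  fixes h :: "real \<Rightarrow> real"
  assumes "continuous_on UNIV h"
  shows "continuous_on UNIV (\<lambda>t. - h (- t))"
  by (intro continuous_intros continuous_on_compose2[OF assms]) auto

lemma left_gap_le:
  fixes h :: "real \<Rightarrow> real"
  assumes "strict_mono h" "continuous_on UNIV h" "0 < y"
  shows "left_gap h x y \<le> h x - h (x - y)"
  using right_gap_le[OF strict_mono_mono[OF reflect_strict_mono[OF assms(1)]]
      reflect_continuous[OF assms(2)] assms(3), of "- x"]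
  by (simp add: left_gap_eq_right_gap_reflect)

lemma left_gap_pos:
  fixes h :: "real \<Rightarrow> real"
  assumes "strict_mono h" "continuous_on UNIV h" "0 < y"
  shows "0 < left_gap h x y"
  unfolding left_gap_eq_right_gap_reflect
  by (intro right_gap_pos reflect_strict_mono reflect_continuous assms)

section \<open>Averages of the symmetric distortion\<close>

lemma symmetric_distortion_nonneg: "0 \<le> symmetric_distortion h x t"
  by (simp add: symmetric_distortion_def le_max_iff_disj)

lemma symmetric_distortion_eq:
  assumes "strict_mono h" "0 < t"
  shows "symmetric_distortion h x t =
    max ((h (x + t) - h x) / (h x - h (x - t))) ((h x - h (x - t)) / (h (x + t) - h x))"
proof -
  have "h x < h (x + t)" "h (x - t) < h x"
    using assms by (auto simp: strict_mono_def)
  then show ?thesis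
    by (simp add: symmetric_distortion_def)
qed

lemma symmetric_distortion_ge_1:
  assumes "strict_mono h" "0 < t"
  shows "1 \<le> symmetric_distortion h x t"
proof -
  have "h x < h (x + t)" "h (x - t) < h x"
    using assms by (auto simp: strict_mono_def)
  then have "1 \<le> (h (x + t) - h x) / (h x - h (x - t)) \<or> 1 \<le> (h x - h (x - t)) / (h (x + t) - h x)"
    by (auto simp: le_divide_eq)
  then show ?thesis
    by (simp add: symmetric_distortion_eq[OF assms] le_max_iff_disj)
qed

lemma integrable_symmetric_distortion:
  fixes h :: "real \<Rightarrow> real"
  assumes "strict_mono h" "continuous_on UNIV h" "0 < y" "- y < a" "b < y"
  shows "(\<lambda>z. symmetric_distortion h (x + z) (y - \<bar>z\<bar>)) integrable_on {a..b}"
proof (rule integrable_continuous_real)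
  have "h (x + z) < h (x + z + (y - \<bar>z\<bar>))" "h (x + z - (y - \<bar>z\<bar>)) < h (x + z)"
    if "z \<in> {a..b}" for z
    using assms that by (auto simp: strict_mono_def)
  then have ne: "\<bar>h (x + z) - h (x + z - (y - \<bar>z\<bar>))\<bar> \<noteq> 0" "\<bar>h (x + z + (y - \<bar>z\<bar>)) - h (x + z)\<bar> \<noteq> 0"
    if "z \<in> {a..b}" for z
    using that by (fastforce)+
  show "continuous_on {a..b} (\<lambda>z. symmetric_distortion h (x + z) (y - \<bar>z\<bar>))"
    unfolding symmetric_distortion_def
    by (intro continuous_intros continuous_on_compose2[OF assms(2)] ballI ne) auto
qed

text \<open>
  The tangent of \<open>1 / d\<close> at \<open>d = m\<close>. Integrating it replaces Jensen's inequality in the lower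
  bound for the integral of an inverse.
\<close>
lemma tangent_le_inverse:
  fixes m d :: real
  assumes "0 < d" "0 < m"
  shows "2 / m - d / m\<^sup>2 \<le> 1 / d"
proof -
  have "1 / d - (2 / m - d / m\<^sup>2) = (m - d)\<^sup>2 / (d * m\<^sup>2)"
    using assms by (simp add: field_simps power2_eq_square)
  then show ?thesis
    using assms by (smt (verit) divide_nonneg_pos mult_pos_pos zero_le_power2 zero_less_power2)
qed

text \<open>
  If the right gap is small, then \<open>h\<close> climbs quickly to the right of \<open>x\<close>, and the intervals
  \<open>[x - y, x + y + 2 z]\<close> with \<open>-y/4 \<le> z \<le> 0\<close>, centred at \<open>x + z\<close>, all have a right half on
  which \<open>h\<close> gains a fixed proportion of its increment over \<open>[x, x + y]\<close>. Their left halves start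
  at \<open>x - y\<close>, and the mean increment over them is governed by the left gap.
\<close>
lemma average_distortion_ge_of_small_right_gap:
  fixes h :: "real \<Rightarrow> real"
  assumes sm: "strict_mono h" and cont: "continuous_on UNIV h" and y: "0 < y"
    and small: "right_gap h x y < (h (x + y) - h x) / 8"
  shows "(h (x + y) - h x) / (16 * left_gap h x y)
     \<le> 2 / y * integral {- (y / 4)..y / 4} (\<lambda>z. symmetric_distortion h (x + z) (y - \<bar>z\<bar>))"
proof -
  define A where "A = h (x + y) - h x"
  define b where "b = left_gap h x y"
  \<comment> \<open>an upper bound for the mean of \<open>D\<close> over \<open>[-y/4, 0]\<close>, where the tangent of the inverse is taken\<close>
  define m where "m = 4 * b"
  define r where "r = (\<lambda>z. symmetric_distortion h (x + z) (y - \<bar>z\<bar>))"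
  define D where "D = (\<lambda>z. h (x + z) - h (x - y))"
  have less: "s < t \<Longrightarrow> h s < h t" for s t
    using sm by (simp add: strict_mono_def)
  have le: "s \<le> t \<Longrightarrow> h s \<le> h t" for s t
    using strict_mono_mono[OF sm] by (simp add: mono_def)
  have b: "0 < b"
    unfolding b_def by (rule left_gap_pos[OF sm cont y])
  then have m: "0 < m" by (simp add: m_def)
  have A: "0 < A" using less[of x "x + y"] y by (simp add: A_def)
  have half: "A / 2 \<le> h (x + y / 2) - h x"
    using half_increment_le_right_gap[OF strict_mono_mono[OF sm] cont y, of x] small A
    by (simp add: A_def)
  have D_pos: "0 < D z" if "- y < z" for z
    using less[of "x - y" "x + z"] that by (simp add: D_def)
  have int_D: "D integrable_on {s..t}" for s t
    unfolding D_def
    by (intro integrable_continuous_real continuous_intros continuous_on_compose2[OF cont]) auto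
  have int_r: "r integrable_on {s..t}" if "- y < s" "t < y" for s t
    unfolding r_def by (rule integrable_symmetric_distortion[OF sm cont y that])
  have r_nonneg: "0 \<le> r z" for z
    by (simp add: r_def symmetric_distortion_nonneg)
  have "integral {- (y / 4)..0} D \<le> integral {- y..0} D"
  proof (rule integral_subset_le[OF _ int_D int_D])
    show "\<forall>z\<in>{- y..0}. 0 \<le> D z" using le by (simp add: D_def)
  qed (use y in auto)
  also have "integral {- y..0} D = integral {- y..0} (\<lambda>z. h (x + z)) - y * h (x - y)"
    unfolding D_def
    by (subst Henstock_Kurzweil_Integration.integral_diff)
      (use y in \<open>auto intro!: integrable_continuous_real continuous_on_compose2[OF cont] continuous_intros\<close>)
  also have "integral {- y..0} (\<lambda>z. h (x + z)) = integral {x - y..x} h"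
    using integral_shift[of "- y" x 0 h] continuous_on_subset[OF cont]
    by (simp add: o_def add.commute)
  also have "\<dots> - y * h (x - y) = y * b"
    using y by (simp add: b_def left_gap_def field_simps)
  finally have int_D_le: "integral {- (y / 4)..0} D \<le> y * b" .
  have r_ge: "A / 2 * (2 / m - D z / m\<^sup>2) \<le> r z" if z: "z \<in> {- (y / 4)..0}" for z
  proof -
    have "A / 2 * (2 / m - D z / m\<^sup>2) \<le> A / 2 * (1 / D z)"
      by (rule mult_left_mono[OF tangent_le_inverse]) (use A m D_pos[of z] z y in auto)
    also have "\<dots> = (A / 2) / D z" by simp
    also have "\<dots> \<le> (h (x + y + 2 * z) - h (x + z)) / D z"
    proof (rule divide_right_mono)
      have "h (x + y / 2) \<le> h (x + y + 2 * z)" "h (x + z) \<le> h x"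
        using z by (auto intro!: le)
      with half show "A / 2 \<le> h (x + y + 2 * z) - h (x + z)" by linarith
      show "0 \<le> D z" using D_pos[of z] z y by simp
    qed
    also have "\<dots> \<le> r z"
    proof -
      have eq: "x + z + (y + z) = x + y + 2 * z" "x + z - (y + z) = x - y" by simp_all
      have "0 < y + z" "\<bar>z\<bar> = - z" using z y by auto
      then show ?thesis
        using symmetric_distortion_eq[OF sm, of "y + z" "x + z"]
        unfolding eq by (simp add: r_def D_def)
    qed
    finally show ?thesis .
  qed
  have lin: "(\<lambda>z. A / 2 * (2 / m - D z / m\<^sup>2)) integrable_on {- (y / 4)..0}"
    unfolding D_def
    by (intro integrable_continuous_real continuous_intros continuous_on_compose2[OF cont]) (use m in auto)
  have int_lin: "integral {- (y / 4)..0} (\<lambda>z. 2 / m - D z / m\<^sup>2)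
      = y / 4 * (2 / m) - integral {- (y / 4)..0} D / m\<^sup>2"
    by (subst Henstock_Kurzweil_Integration.integral_diff)
      (use y in \<open>auto intro: integrable_on_divide int_D\<close>)
  have "A * y / (32 * b) = A / 2 * (y / 4 * (2 / m) - y * b / m\<^sup>2)"
    using b by (simp add: m_def field_simps power2_eq_square)
  also have "\<dots> \<le> A / 2 * (y / 4 * (2 / m) - integral {- (y / 4)..0} D / m\<^sup>2)"
    using A m int_D_le by (intro mult_left_mono diff_left_mono divide_right_mono) auto
  also have "\<dots> = integral {- (y / 4)..0} (\<lambda>z. A / 2 * (2 / m - D z / m\<^sup>2))"
    using int_lin by simp
  also have "\<dots> \<le> integral {- (y / 4)..0} r"
    by (rule integral_le[OF lin int_r r_ge]) (use y in auto)
  also have "\<dots> \<le> integral {- (y / 4)..y / 4} r"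
    by (rule integral_subset_le[OF _ int_r int_r]) (use y r_nonneg in auto)
  finally have "2 / y * (A * y / (32 * b)) \<le> 2 / y * integral {- (y / 4)..y / 4} r"
    using y by (intro mult_left_mono) auto
  moreover have "2 / y * (A * y / (32 * b)) = A / (16 * b)"
    using y by simp
  ultimately show ?thesis
    by (simp only: A_def b_def r_def)
qed

lemma average_distortion_ge_of_small_left_gap:
  fixes h :: "real \<Rightarrow> real"
  assumes sm: "strict_mono h" and cont: "continuous_on UNIV h" and y: "0 < y"
    and small: "left_gap h x y < (h x - h (x - y)) / 8"
  shows "(h x - h (x - y)) / (16 * right_gap h x y)
     \<le> 2 / y * integral {- (y / 4)..y / 4} (\<lambda>z. symmetric_distortion h (x + z) (y - \<bar>z\<bar>))"
proof -
  let ?g = "\<lambda>t. - h (- t)"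
  let ?r = "\<lambda>z. symmetric_distortion h (x + z) (y - \<bar>z\<bar>)"
  have "symmetric_distortion ?g (- x + z) (y - \<bar>z\<bar>) = ?r (- z)" for z
    using symmetric_distortion_reflect[of h "x - z" "y - \<bar>z\<bar>"] by simp
  then have "integral {- (y / 4)..y / 4} (\<lambda>z. symmetric_distortion ?g (- x + z) (y - \<bar>z\<bar>))
      = integral {- (y / 4)..y / 4} (\<lambda>z. ?r (- z))"
    by simp
  also have "\<dots> = integral {- (y / 4)..y / 4} ?r"
    using Henstock_Kurzweil_Integration.integral_reflect_real[of "y / 4" "- (y / 4)" ?r] by simp
  finally show ?thesis
    using average_distortion_ge_of_small_right_gap[OF reflect_strict_mono[OF sm] reflect_continuous[OF cont] y, of "- x"] small
    by (simp add: left_gap_eq_right_gap_reflect[of h x y] right_gap_eq_left_gap_reflect[of h x y])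
qed

section \<open>The derivative of the extension\<close>

lemma onorm_matrix2_upper:
  fixes a b c d :: real
  shows "(onorm (\<lambda>w. (vector [vector [a, b], vector [c, d]] :: real^2^2) *v w))\<^sup>2
    \<le> a\<^sup>2 + b\<^sup>2 + c\<^sup>2 + d\<^sup>2"
proof -
  let ?M = "vector [vector [a, b], vector [c, d]] :: real^2^2"
  let ?F = "a\<^sup>2 + b\<^sup>2 + c\<^sup>2 + d\<^sup>2"
  have "norm (?M *v w) \<le> sqrt ?F * norm w" for w :: "real^2"
  proof -
    \<comment> \<open>Lagrange's identity for each row\<close>
    have "(a * w$1 + b * w$2)\<^sup>2 + (c * w$1 + d * w$2)\<^sup>2
        + (a * w$2 - b * w$1)\<^sup>2 + (c * w$2 - d * w$1)\<^sup>2
        = ?F * ((w$1)\<^sup>2 + (w$2)\<^sup>2)"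
      by (simp add: algebra_simps power2_eq_square)
    then have "(a * w$1 + b * w$2)\<^sup>2 + (c * w$1 + d * w$2)\<^sup>2 \<le> ?F * ((w$1)\<^sup>2 + (w$2)\<^sup>2)"
      by (smt (verit) zero_le_power2)
    then show ?thesis
      by (simp add: norm_vec_def L2_set_def sum_2 matrix_vector_mult_def
          flip: real_sqrt_mult)
  qed
  then have "onorm ((*v) ?M) \<le> sqrt ?F"
    by (intro onorm_bound) auto
  moreover have "0 \<le> onorm ((*v) ?M)"
    by (rule onorm_pos_le) (rule matrix_vector_mul_bounded_linear)
  ultimately have "(onorm ((*v) ?M))\<^sup>2 \<le> (sqrt ?F)\<^sup>2"
    by (rule power_mono)
  then show ?thesis by simp
qed

lemma onorm_matrix2_first_column:
  fixes a b c d :: real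
  shows "a\<^sup>2 + c\<^sup>2 \<le> (onorm (\<lambda>w. (vector [vector [a, b], vector [c, d]] :: real^2^2) *v w))\<^sup>2"
proof -
  let ?M = "vector [vector [a, b], vector [c, d]] :: real^2^2"
  have "norm (?M *v vector [1, 0]) \<le> onorm ((*v) ?M) * norm (vector [1, 0] :: real^2)"
    by (rule onorm) (rule matrix_vector_mul_bounded_linear)
  then have "sqrt (a\<^sup>2 + c\<^sup>2) \<le> onorm ((*v) ?M)"
    by (simp add: norm_vec_def L2_set_def sum_2 matrix_vector_mult_def)
  then have "(sqrt (a\<^sup>2 + c\<^sup>2))\<^sup>2 \<le> (onorm ((*v) ?M))\<^sup>2"
    by (rule power_mono) simp
  then show ?thesis by simp
qed

text \<open>
  Near \<open>(x, y)\<close> both components are elementary expressions in an antiderivative of \<open>h\<close>. The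
  derivative of the factor \<open>1 / (2 y)\<close> brings in the means of \<open>h\<close>, and these combine with
  the endpoint values into the gaps.
\<close>
lemma has_derivative_beurling_ahlfors:
  fixes h :: "real \<Rightarrow> real" and x y :: real
  assumes cont: "continuous_on UNIV h" and y: "0 < y"
  defines "A \<equiv> h (x + y) - h x" and "B \<equiv> h x - h (x - y)"
    and "\<alpha> \<equiv> right_gap h x y" and "\<beta> \<equiv> left_gap h x y"
  shows "(beurling_ahlfors h has_derivative
    (\<lambda>w. (vector [vector [(A + B) / (2 * y), (\<alpha> - \<beta>) / (2 * y)],
                  vector [(A - B) / (2 * y), (\<alpha> + \<beta>) / (2 * y)]] :: real^2^2) *v w))
    (at (vector [x, y]))"
proof -
  \<comment> \<open>an interval with \<open>x - y\<close> and \<open>x + y\<close> in its interior, so that it serves for all nearby points\<close>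
  define I where "I = {x - 2 * y..x + 2 * y}"
  have "continuous_on I h" by (rule continuous_on_subset[OF cont]) simp
  then obtain G where G: "\<And>t. t \<in> I \<Longrightarrow> (G has_vector_derivative h t) (at t within I)"
    unfolding I_def by (metis antiderivative_continuous)
  have int_G: "integral {s..t} h = G t - G s" if "s \<le> t" "x - 2 * y \<le> s" "t \<le> x + 2 * y" for s t
  proof (rule integral_unique, rule fundamental_theorem_of_calculus[OF that(1)])
    fix u assume "u \<in> {s..t}"
    then show "(G has_vector_derivative h u) (at u within {s..t})"
      using that by (intro has_vector_derivative_within_subset[OF G]) (auto simp: I_def)
  qed
  have DG: "(G has_derivative (\<lambda>s. s * h t)) (at t)" if "t \<in> {x - 2 * y<..<x + 2 * y}" for t
  proof -
    have "at t within I = at t"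
      using that unfolding I_def by (intro at_within_interior) auto
    then show ?thesis
      using G[of t] that by (simp add: I_def has_vector_derivative_def)
  qed
  let ?p = "vector [x, y] :: real^2"
  let ?u = "\<lambda>q::real^2. 1 / (2 * q$2) * (G (q$1 + q$2) - G (q$1 - q$2))"
  let ?v = "\<lambda>q::real^2. 1 / (2 * q$2) * (G (q$1 + q$2) + G (q$1 - q$2) - 2 * G (q$1))"
  define S where "S = {q::real^2. 0 < q$2} \<inter> {q. q$1 + q$2 < x + 2 * y} \<inter> {q. x - 2 * y < q$1 - q$2}"
  have "open S"
    unfolding S_def by (intro open_Int open_Collect_less continuous_intros)
  have pS: "?p \<in> S" using y by (simp add: S_def)
  have eq: "?u q *\<^sub>R vector [1, 0] + ?v q *\<^sub>R vector [0, 1] = beurling_ahlfors h q" if "q \<in> S" for q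
  proof -
    have "0 < q$2" "q$1 + q$2 < x + 2 * y" "x - 2 * y < q$1 - q$2"
      using that by (auto simp: S_def)
    then have "beurling_ahlfors h q = vector [?u q, ?v q]"
      by (simp add: beurling_ahlfors_def ba_u_def ba_v_def int_G)
    then show ?thesis by (simp add: vec_eq_iff forall_2)
  qed
  have D1: "((\<lambda>q::real^2. q$1) has_derivative (\<lambda>w. w$1)) (at ?p)"
   and D2: "((\<lambda>q::real^2. q$2) has_derivative (\<lambda>w. w$2)) (at ?p)"
    by (intro bounded_linear_imp_has_derivative bounded_linear_vec_nth)+
  have Dp: "((\<lambda>q::real^2. G (q$1 + q$2)) has_derivative (\<lambda>w. (w$1 + w$2) * h (x + y))) (at ?p)"
    by (rule has_derivative_compose[OF has_derivative_add[OF D1 D2]]) (use DG[of "x + y"] y in simp)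
  have Dm: "((\<lambda>q::real^2. G (q$1 - q$2)) has_derivative (\<lambda>w. (w$1 - w$2) * h (x - y))) (at ?p)"
    by (rule has_derivative_compose[OF has_derivative_diff[OF D1 D2]]) (use DG[of "x - y"] y in simp)
  have D0: "((\<lambda>q::real^2. G (q$1)) has_derivative (\<lambda>w. w$1 * h x)) (at ?p)"
    by (rule has_derivative_compose[OF D1]) (use DG[of x] y in simp)
  have \<alpha>: "\<alpha> = h (x + y) - (G (x + y) - G x) / y"
    and \<beta>: "\<beta> = (G x - G (x - y)) / y - h (x - y)"
    using y by (simp_all add: \<alpha>_def \<beta>_def right_gap_def left_gap_def int_G)
  have Du: "(?u has_derivative (\<lambda>w. (A + B) / (2 * y) * w$1 + (\<alpha> - \<beta>) / (2 * y) * w$2)) (at ?p)"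
  proof -
    have "(?u has_derivative (\<lambda>w. ((w$1 + w$2) * h (x + y) - (w$1 - w$2) * h (x - y)) / (2 * y)
        - w$2 / (2 * y\<^sup>2) * (G (x + y) - G (x - y)))) (at ?p)"
      by (rule derivative_eq_intros Dp Dm D2 | (use y in \<open>simp add: field_simps power2_eq_square\<close>))+
    moreover have "((w1 + w2) * h (x + y) - (w1 - w2) * h (x - y)) / (2 * y)
        - w2 / (2 * y\<^sup>2) * (G (x + y) - G (x - y))
        = (A + B) / (2 * y) * w1 + (\<alpha> - \<beta>) / (2 * y) * w2" for w1 w2
    proof -
      have gap: "(\<alpha> - \<beta>) / (2 * y) = (h (x + y) + h (x - y)) / (2 * y) - (G (x + y) - G (x - y)) / (2 * y\<^sup>2)"
        unfolding \<alpha> \<beta> using y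
        by (simp add: power2_eq_square add_divide_distrib diff_divide_distrib)
      show ?thesis
        unfolding gap A_def B_def by (simp add: add_divide_distrib diff_divide_distrib algebra_simps)
    qed
    ultimately show ?thesis by (simp only:)
  qed
  have Dv: "(?v has_derivative (\<lambda>w. (A - B) / (2 * y) * w$1 + (\<alpha> + \<beta>) / (2 * y) * w$2)) (at ?p)"
  proof -
    have "(?v has_derivative (\<lambda>w. ((w$1 + w$2) * h (x + y) - 2 * (w$1 * h x) + (w$1 - w$2) * h (x - y)) / (2 * y)
        - w$2 / (2 * y\<^sup>2) * (G (x + y) - 2 * G x + G (x - y)))) (at ?p)"
      by (rule derivative_eq_intros Dp Dm D0 D2 | (use y in \<open>simp add: field_simps power2_eq_square\<close>))+
    moreover have "((w1 + w2) * h (x + y) - 2 * (w1 * h x) + (w1 - w2) * h (x - y)) / (2 * y)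
        - w2 / (2 * y\<^sup>2) * (G (x + y) - 2 * G x + G (x - y))
        = (A - B) / (2 * y) * w1 + (\<alpha> + \<beta>) / (2 * y) * w2" for w1 w2
    proof -
      have gap: "(\<alpha> + \<beta>) / (2 * y) = (h (x + y) - h (x - y)) / (2 * y) - (G (x + y) - 2 * G x + G (x - y)) / (2 * y\<^sup>2)"
        unfolding \<alpha> \<beta> using y
        by (simp add: power2_eq_square add_divide_distrib diff_divide_distrib)
      show ?thesis
        unfolding gap A_def B_def by (simp add: add_divide_distrib diff_divide_distrib algebra_simps)
    qed
    ultimately show ?thesis by (simp only:)
  qed
  have "((\<lambda>q. ?u q *\<^sub>R vector [1, 0] + ?v q *\<^sub>R (vector [0, 1] :: real^2)) has_derivative
     (\<lambda>w. ((A + B) / (2 * y) * w$1 + (\<alpha> - \<beta>) / (2 * y) * w$2) *\<^sub>R vector [1, 0]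
        + ((A - B) / (2 * y) * w$1 + (\<alpha> + \<beta>) / (2 * y) * w$2) *\<^sub>R vector [0, 1])) (at ?p)"
    by (intro has_derivative_add has_derivative_scaleR_left Du Dv)
  moreover have "(\<lambda>w. ((A + B) / (2 * y) * w$1 + (\<alpha> - \<beta>) / (2 * y) * w$2) *\<^sub>R vector [1, 0]
        + ((A - B) / (2 * y) * w$1 + (\<alpha> + \<beta>) / (2 * y) * w$2) *\<^sub>R vector [0, 1])
      = (\<lambda>w. (vector [vector [(A + B) / (2 * y), (\<alpha> - \<beta>) / (2 * y)],
                  vector [(A - B) / (2 * y), (\<alpha> + \<beta>) / (2 * y)]] :: real^2^2) *v w)"
    by (simp add: fun_eq_iff vec_eq_iff forall_2 matrix_vector_mult_def sum_2)
  ultimately show ?thesis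
    using has_derivative_transform_within_open[OF _ \<open>open S\<close> pS eq] by simp
qed

lemma jacobian_beurling_ahlfors:
  fixes h :: "real \<Rightarrow> real" and x y :: real
  assumes "continuous_on UNIV h" "0 < y"
  defines "A \<equiv> h (x + y) - h x" and "B \<equiv> h x - h (x - y)"
    and "\<alpha> \<equiv> right_gap h x y" and "\<beta> \<equiv> left_gap h x y"
  shows "jacobian (beurling_ahlfors h) (at (vector [x, y])) =
    vector [vector [(A + B) / (2 * y), (\<alpha> - \<beta>) / (2 * y)],
            vector [(A - B) / (2 * y), (\<alpha> + \<beta>) / (2 * y)]]"
  using frechet_derivative_at[OF has_derivative_beurling_ahlfors[OF assms(1,2), of x], symmetric]
  by (simp add: jacobian_def A_def B_def \<alpha>_def \<beta>_def matrix_of_matrix_vector_mul)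

section \<open>The dilatation bounds\<close>

text \<open>
  The case distinction of the upper bound: if \<open>\<alpha>\<close> is comparable to \<open>A\<close>, the summand \<open>B \<alpha>\<close> of the
  Jacobian suffices, otherwise the summand \<open>A \<beta>\<close> does. Here \<open>R\<close> stands for the maximum of the
  distortion and its average. The roles of \<open>(A, \<alpha>)\<close> and \<open>(B, \<beta>)\<close> can be exchanged.
\<close>
lemma sum_squares_le_distortion_times_jacobian:
  fixes A B \<alpha> \<beta> R :: real
  assumes "0 < B" "B \<le> A" "0 < \<alpha>" "\<alpha> \<le> A" "0 < \<beta>" "\<beta> \<le> B"
    and ratio: "A / B \<le> R" and small: "\<alpha> < A / 8 \<Longrightarrow> A / (16 * \<beta>) \<le> R"
  shows "A\<^sup>2 + B\<^sup>2 + \<alpha>\<^sup>2 + \<beta>\<^sup>2 \<le> 64 * R * (A * \<beta> + B * \<alpha>)"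
proof -
  have "0 < A / B" using assms by simp
  then have R: "0 < R" using ratio by linarith
  have "B\<^sup>2 \<le> A\<^sup>2" "\<alpha>\<^sup>2 \<le> A\<^sup>2" "\<beta>\<^sup>2 \<le> A\<^sup>2"
    using assms by (auto intro!: power_mono)
  then have "A\<^sup>2 + B\<^sup>2 + \<alpha>\<^sup>2 + \<beta>\<^sup>2 \<le> 4 * A\<^sup>2" by simp
  also have "\<dots> \<le> 64 * R * (A * \<beta> + B * \<alpha>)"
  proof (cases "\<alpha> < A / 8")
    case True
    then have "A \<le> 16 * (R * \<beta>)"
      using small assms by (simp add: field_simps)
    then have "A * A \<le> A * (16 * (R * \<beta>))"
      using assms by (intro mult_left_mono) auto
    moreover have "0 \<le> R * (B * \<alpha>)" using R assms by simp
    ultimately show ?thesis by (simp add: power2_eq_square algebra_simps)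
  next
    case False
    have "A \<le> R * B" using ratio assms by (simp add: field_simps)
    then have "A * (A / 8) \<le> (R * B) * \<alpha>"
      using False assms R by (intro mult_mono) auto
    moreover have "A * (A / 8) = A\<^sup>2 / 8" by (simp add: power2_eq_square)
    moreover have "0 \<le> R * (A * \<beta>)" using R assms by simp
    moreover have "64 * R * (A * \<beta> + B * \<alpha>) = 64 * (R * (A * \<beta>)) + 64 * (R * B * \<alpha>)"
      by (simp add: algebra_simps)
    ultimately show ?thesis using zero_le_power2[of A] by linarith
  qed
  finally show ?thesis .
qed

lemma ba_dilatation_bounds:
  fixes h :: "real \<Rightarrow> real"
  assumes sm: "strict_mono h" and cont: "continuous_on UNIV h" and y: "0 < y"
  shows "ereal (symmetric_distortion h x y / 4) \<le> ba_dilatation h x y"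
    and "ba_dilatation h x y \<le> ereal (64 * max (symmetric_distortion h x y)
      (2 / y * integral {- (y / 4)..y / 4} (\<lambda>z. symmetric_distortion h (x + z) (y - \<bar>z\<bar>))))"
proof -
  define A where "A = h (x + y) - h x"
  define B where "B = h x - h (x - y)"
  define \<alpha> where "\<alpha> = right_gap h x y"
  define \<beta> where "\<beta> = left_gap h x y"
  define J where "J = jacobian (beurling_ahlfors h) (at (vector [x, y]))"
  define \<rho> where "\<rho> = symmetric_distortion h x y"
  define R where "R = max \<rho> (2 / y * integral {- (y / 4)..y / 4}
    (\<lambda>z. symmetric_distortion h (x + z) (y - \<bar>z\<bar>)))"
  have A: "0 < A" and B: "0 < B"
    using sm y by (auto simp: A_def B_def strict_mono_def)
  have \<alpha>: "0 < \<alpha>" "\<alpha> \<le> A"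
    using right_gap_pos[OF sm cont y] right_gap_le[OF strict_mono_mono[OF sm] cont y]
    by (auto simp: \<alpha>_def A_def)
  have \<beta>: "0 < \<beta>" "\<beta> \<le> B"
    using left_gap_pos[OF sm cont y] left_gap_le[OF sm cont y] by (auto simp: \<beta>_def B_def)
  have J: "J = vector [vector [(A + B) / (2 * y), (\<alpha> - \<beta>) / (2 * y)],
                       vector [(A - B) / (2 * y), (\<alpha> + \<beta>) / (2 * y)]]"
    unfolding J_def A_def B_def \<alpha>_def \<beta>_def by (rule jacobian_beurling_ahlfors[OF cont y])
  have det: "det J = 2 * (A * \<beta> + B * \<alpha>) / (2 * y)\<^sup>2"
    using y by (simp add: J det_2 field_simps power2_eq_square)
  have dil: "ba_dilatation h x y = Inf {ereal K |K. K \<ge> 1 \<and> (onorm (\<lambda>w. J *v w))\<^sup>2 \<le> K * det J}"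
    by (simp add: ba_dilatation_def dilatation_def J_def)
  have \<rho>: "\<rho> = max (A / B) (B / A)"
    unfolding \<rho>_def A_def B_def by (rule symmetric_distortion_eq[OF sm y])

  show "ereal (symmetric_distortion h x y / 4) \<le> ba_dilatation h x y"
    unfolding dil
  proof (rule Inf_greatest, clarsimp)
    fix K :: real
    assume K: "1 \<le> K" "(onorm (\<lambda>w. J *v w))\<^sup>2 \<le> K * det J"
    have "2 * (A\<^sup>2 + B\<^sup>2) / (2 * y)\<^sup>2 = ((A + B) / (2 * y))\<^sup>2 + ((A - B) / (2 * y))\<^sup>2"
      using y by (simp add: field_simps power2_eq_square)
    also have "\<dots> \<le> (onorm (\<lambda>w. J *v w))\<^sup>2"
      unfolding J by (rule onorm_matrix2_first_column)
    also have "\<dots> \<le> K * det J" by (rule K)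
    also have "\<dots> = 2 * (K * (A * \<beta> + B * \<alpha>)) / (2 * y)\<^sup>2"
      by (simp only: det) (simp add: algebra_simps)
    finally have "A\<^sup>2 + B\<^sup>2 \<le> K * (A * \<beta> + B * \<alpha>)"
      using y unfolding divide_le_cancel by auto
    also have "\<dots> \<le> K * (A * B + B * A)"
      using K A B \<alpha> \<beta> by (intro mult_left_mono add_mono) auto
    finally have *: "A\<^sup>2 + B\<^sup>2 \<le> 2 * K * (A * B)" by (simp add: algebra_simps)
    have "A\<^sup>2 \<le> 2 * K * (A * B)" "B\<^sup>2 \<le> 2 * K * (A * B)"
      using * zero_le_power2[of A] zero_le_power2[of B] by linarith+
    then have "A / B \<le> 2 * K" "B / A \<le> 2 * K"
      using A B by (simp_all add: divide_le_eq power2_eq_square)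
    then show "symmetric_distortion h x y \<le> K * 4"
      using \<rho> K by (simp add: \<rho>_def)
  qed

  have "1 \<le> \<rho>" unfolding \<rho>_def by (rule symmetric_distortion_ge_1[OF sm y])
  then have R1: "1 \<le> 64 * R" by (simp add: R_def)
  have ratio: "A / B \<le> R" "B / A \<le> R" by (auto simp: R_def \<rho>)
  have left: "\<alpha> < A / 8 \<Longrightarrow> A / (16 * \<beta>) \<le> R"
    using average_distortion_ge_of_small_right_gap[OF sm cont y, of x]
    by (simp add: R_def A_def \<alpha>_def \<beta>_def)
  have right: "\<beta> < B / 8 \<Longrightarrow> B / (16 * \<alpha>) \<le> R"
    using average_distortion_ge_of_small_left_gap[OF sm cont y, of x]
    by (simp add: R_def B_def \<alpha>_def \<beta>_def)
  have key: "A\<^sup>2 + B\<^sup>2 + \<alpha>\<^sup>2 + \<beta>\<^sup>2 \<le> 64 * R * (A * \<beta> + B * \<alpha>)"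
  proof (cases "B \<le> A")
    case True
    then show ?thesis
      using sum_squares_le_distortion_times_jacobian[OF B _ \<alpha> \<beta> ratio(1) left] by simp
  next
    case False
    then show ?thesis
      using sum_squares_le_distortion_times_jacobian[OF A _ \<beta> \<alpha> ratio(2) right]
      by (simp add: algebra_simps)
  qed
  have "(onorm (\<lambda>w. J *v w))\<^sup>2 \<le> ((A + B) / (2 * y))\<^sup>2 + ((\<alpha> - \<beta>) / (2 * y))\<^sup>2
      + ((A - B) / (2 * y))\<^sup>2 + ((\<alpha> + \<beta>) / (2 * y))\<^sup>2"
    unfolding J by (rule onorm_matrix2_upper)
  also have "\<dots> = 2 * (A\<^sup>2 + B\<^sup>2 + \<alpha>\<^sup>2 + \<beta>\<^sup>2) / (2 * y)\<^sup>2"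
    using y by (simp add: field_simps power2_eq_square)
  also have "\<dots> \<le> 2 * (64 * R * (A * \<beta> + B * \<alpha>)) / (2 * y)\<^sup>2"
    using key by (intro divide_right_mono mult_left_mono) auto
  also have "\<dots> = (64 * R) * det J" by (simp add: det)
  finally have "ba_dilatation h x y \<le> ereal (64 * R)"
    unfolding dil using R1 by (intro Inf_lower) blast
  then show "ba_dilatation h x y \<le> ereal (64 * max (symmetric_distortion h x y)
      (2 / y * integral {- (y / 4)..y / 4} (\<lambda>z. symmetric_distortion h (x + z) (y - \<bar>z\<bar>))))"
    by (simp only: R_def \<rho>_def)
qed

theorem theorem1p6:
  "\<exists>C\<^sub>0::real. C\<^sub>0 > 0 \<and>
     (\<forall>h::real \<Rightarrow> real. strict_mono h \<and> (\<exists>g. homeomorphism UNIV UNIV h g) \<longrightarrow>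
       (\<forall>x y. y > 0 \<longrightarrow>
          ereal (symmetric_distortion h x y / 4) \<le> ba_dilatation h x y \<and>
          ba_dilatation h x y \<le>
            ereal (C\<^sub>0 * max (symmetric_distortion h x y)
                     (2 / y * integral {- (y / 4)..y / 4}
                        (\<lambda>z. symmetric_distortion h (x + z) (y - \<bar>z\<bar>))))))"
proof (intro exI[of _ "64::real"] conjI allI impI)
  fix h :: "real \<Rightarrow> real" and x y :: real
  assume "strict_mono h \<and> (\<exists>g. homeomorphism UNIV UNIV h g)" and y: "0 < y"
  then have sm: "strict_mono h" and cont: "continuous_on UNIV h"
    by (auto simp: homeomorphism_def)
  show "ereal (symmetric_distortion h x y / 4) \<le> ba_dilatation h x y"
    by (rule ba_dilatation_bounds[OF sm cont y])
  show "ba_dilatation h x y \<le> ereal (64 * max (symmetric_distortion h x y)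
      (2 / y * integral {- (y / 4)..y / 4} (\<lambda>z. symmetric_distortion h (x + z) (y - \<bar>z\<bar>))))"
    by (rule ba_dilatation_bounds[OF sm cont y])
qed simp

end
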